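(* There is a $\preceq_c$ and $\preceq^i_c$-descending chain $\big((\Sigma_p,G_{\sigma_{|\Sigma_p}})\big)_{p\in\omega}$, that is, for each $p\in\omega$, $(\Sigma_{p+1},G_{\sigma_{|\Sigma_{p+1}}})\preceq^i_c(\Sigma_p,G_{\sigma_{|\Sigma_p}})$ (hence also $\preceq_c$) and $(\Sigma_p,G_{\sigma_{|\Sigma_p}})\not\preceq_c(\Sigma_{p+1},G_{\sigma_{|\Sigma_{p+1}}})$ (hence also $\not\preceq^i_c$), where, for each $p$, $\Sigma_p$ is a two-sided subshift, $(\sigma_{|\Sigma_p})^2$ is fixed point free, and $(\Sigma_p,G_{\sigma_{|\Sigma_p}})$ has CCN three.
   Context: An alphabet is a finite set $A$ of cardinality at least two; the shift $\sigma:A^{\mathbb{Z}}\to A^{\mathbb{Z}}$ is $\sigma(\alpha)(k)=\alpha(k+1)$; a two-sided subshift is a closed subset $\Sigma$ of $A^{\mathbb{Z}}$ (for some alphabet $A$) with $\sigma[\Sigma]=\Sigma$; $\sigma_{|\Sigma}$ is the restriction of $\sigma$ to $\Sigma$. If $f:X\to X$ is a function, the graph induced by $f$ is $G_f=\big(\mathrm{Graph}(f)\cup\mathrm{Graph}(f)^{-1}\big)\setminus\Delta(X)$, $\Delta(X)$ being the diagonal. The continuous chromatic number (CCN) of $(X,R)$ is the least cardinal $\kappa\leq\aleph_0$ for which there is a continuous map $c:X\to\kappa$ ($\kappa$ discrete) with $c(x)\neq c(y)$ whenever $(x,y)\in R$, if it exists, and $2^{\aleph_0}$ otherwise. $(X,R)\preceq_c(Y,S)$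 means that there is a continuous $\varphi:X\to Y$ with $R\subseteq(\varphi\times\varphi)^{-1}(S)$; $(X,R)\preceq^i_c(Y,S)$ means that moreover $\varphi$ can be chosen injective. *)

theory Defs
  imports "HOL-Analysis.Analysis" "HOL-Library.Extended_Nat"
begin

definition alphabet :: "'a set \<Rightarrow> bool" where
  "alphabet A \<longleftrightarrow> finite A \<and> 2 \<le> card A"

definition shift :: "(int \<Rightarrow> 'a) \<Rightarrow> int \<Rightarrow> 'a" where
  "shift \<alpha> = (\<lambda>k. \<alpha> (k + 1))"

definition full_shift :: "'a set \<Rightarrow> (int \<Rightarrow> 'a) topology" where
  "full_shift A = product_topology (\<lambda>_. discrete_topology A) UNIV"

definition two_sided_subshift :: "'a set \<Rightarrow> (int \<Rightarrow> 'a) set \<Rightarrow> bool" where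
  "two_sided_subshift A \<Sigma> \<longleftrightarrow> closedin (full_shift A) \<Sigma> \<and> shift ` \<Sigma> = \<Sigma>"

definition subshift_space :: "'a set \<Rightarrow> (int \<Rightarrow> 'a) set \<Rightarrow> (int \<Rightarrow> 'a) topology" where
  "subshift_space A \<Sigma> = subtopology (full_shift A) \<Sigma>"

text \<open>Only the values of \<open>f\<close> on \<open>X\<close> matter, so this is the graph induced by the
  restriction of \<open>f\<close> to \<open>X\<close>.\<close>

definition induced_graph :: "'a set \<Rightarrow> ('a \<Rightarrow> 'a) \<Rightarrow> ('a \<times> 'a) set" where
  "induced_graph X f = ((\<lambda>x. (x, f x)) ` X \<union> ((\<lambda>x. (x, f x)) ` X)\<inverse>) - Id_on X"

text \<open>A cardinal \<open>\<kappa> \<le> \<aleph>\<^sub>0\<close> is encoded as an extended natural number (with \<open>\<infinity>\<close> for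
  \<open>\<aleph>\<^sub>0\<close>), and identified with the von Neumann style set of colours \<open>{i. enat i < \<kappa>}\<close>.\<close>

definition continuous_colouring ::
    "'a topology \<Rightarrow> ('a \<times> 'a) set \<Rightarrow> enat \<Rightarrow> ('a \<Rightarrow> nat) \<Rightarrow> bool" where
  "continuous_colouring X R \<kappa> c \<longleftrightarrow>
     continuous_map X (discrete_topology {i. enat i < \<kappa>}) c \<and> (\<forall>(x, y) \<in> R. c x \<noteq> c y)"

text \<open>\<open>Continuum\<close> stands for the cardinal \<open>2\<close> to the power \<open>\<aleph>\<^sub>0\<close>.\<close>

datatype ccn_value = Countable enat | Continuum

definition ccn :: "'a topology \<Rightarrow> ('a \<times> 'a) set \<Rightarrow> ccn_value" where
  "ccn X R =
     (if \<exists>\<kappa> c. continuous_colouring X R \<kappa> c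
      then Countable (LEAST \<kappa>. \<exists>c. continuous_colouring X R \<kappa> c)
      else Continuum)"

definition reducible_c ::
    "'a topology \<times> ('a \<times> 'a) set \<Rightarrow> 'b topology \<times> ('b \<times> 'b) set \<Rightarrow> bool"
    (infix \<open>\<preceq>\<^sub>c\<close> 50) where
  "G \<preceq>\<^sub>c H \<longleftrightarrow> (\<exists>\<phi>. continuous_map (fst G) (fst H) \<phi> \<and> snd G \<subseteq> inv_image (snd H) \<phi>)"

definition reducible_ci ::
    "'a topology \<times> ('a \<times> 'a) set \<Rightarrow> 'b topology \<times> ('b \<times> 'b) set \<Rightarrow> bool"
    (infix \<open>\<preceq>\<^sub>c\<^sub>i\<close> 50) where
  "G \<preceq>\<^sub>c\<^sub>i H \<longleftrightarrow> (\<exists>\<phi>. continuous_map (fst G) (fst H) \<phi> \<and> inj_on \<phi> (topspace (fst G)) \<and>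
     snd G \<subseteq> inv_image (snd H) \<phi>)"

definition shift_graph ::
    "'a set \<Rightarrow> (int \<Rightarrow> 'a) set \<Rightarrow> (int \<Rightarrow> 'a) topology \<times> ((int \<Rightarrow> 'a) \<times> (int \<Rightarrow> 'a)) set" where
  "shift_graph A \<Sigma> = (subshift_space A \<Sigma>, induced_graph \<Sigma> shift)"

end

theory Submission
  imports Defs
begin

text \<open>
  The chain is separated by odd girth, and the inclusions make it descend.  A finite odd cycle
  maps to every shorter odd cycle, but never injectively, so each \<open>\<Sigma>\<^sub>p\<close> carries infinitely
  many odd cycles at once, arranged in such a way that passing to the limit creates no short cycle.

  Take the cycle \<open>0 1 2 3\<close> of length four as a background and allow a defect, the shortcut from
  \<open>2\<close> directly to \<open>0\<close>.  The symbols alternate in parity except at a defect, so a point of odd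
  period contains a defect, and then it contains a second one at a distance equal to that
  period.  If \<open>\<Sigma>\<^sub>p\<close> consists of the sequences whose defects are at least \<open>4 p + 3\<close> apart, then
  \<open>\<Sigma>\<^sub>p\<close> is closed, decreases with \<open>p\<close>, contains a point of period \<open>4 p + 3\<close> (lemma
  \<open>defect_cycle_in_spaced\<close>), and contains no point of smaller odd period (lemma
  \<open>odd_period_ge\<close>).  A homomorphism between shift graphs sends the orbit of a point of odd
  period \<open>n\<close> to a closed walk along an orbit, and so produces a point of odd period at most
  \<open>n\<close> (lemma \<open>shift_hom_odd_period\<close>).  Hence \<open>\<Sigma>\<^sub>p\<close> does not map to \<open>\<Sigma>\<^sub>p\<^sub>+\<^sub>1\<close>.

  The odd cycle also rules out two colours.  Three suffice, because identifying \<open>1\<close>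
  with \<open>3\<close> in the transition graph leaves a triangle.
\<close>

section \<open>Shift graphs\<close>

lemma shift_funpow: "(shift ^^ n) \<alpha> = (\<lambda>k. \<alpha> (k + int n))"
  by (induction n arbitrary: \<alpha>) (auto simp: shift_def algebra_simps)

text \<open>Fixing finitely many coordinates gives a basic open set of the product topology, so
  non-membership that is visible in a finite window is an open condition.\<close>

lemma closedin_full_shift_if_local:
  assumes sub: "\<Sigma> \<subseteq> topspace (full_shift A)"
    and loc: "\<And>\<alpha>. \<alpha> \<in> topspace (full_shift A) - \<Sigma> \<Longrightarrow>
      \<exists>F. finite F \<and> (\<forall>\<beta>. (\<forall>i\<in>F. \<beta> i = \<alpha> i) \<longrightarrow> \<beta> \<notin> \<Sigma>)"
  shows "closedin (full_shift A) \<Sigma>"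
proof -
  have "openin (full_shift A) (topspace (full_shift A) - \<Sigma>)"
  proof (subst openin_subopen, intro ballI)
    fix \<alpha> assume a: "\<alpha> \<in> topspace (full_shift A) - \<Sigma>"
    then obtain F where F: "finite F" "\<And>\<beta>. \<forall>i\<in>F. \<beta> i = \<alpha> i \<Longrightarrow> \<beta> \<notin> \<Sigma>"
      using loc by blast
    define U where "U = Pi\<^sub>E UNIV (\<lambda>i. if i \<in> F then {\<alpha> i} else A)"
    have aA: "\<alpha> i \<in> A" for i
      using a by (auto simp: full_shift_def PiE_iff)
    have fin: "finite {i. (if i \<in> F then {\<alpha> i} else A) \<noteq> A}"
      by (rule finite_subset[OF _ F(1)]) auto
    have "openin (full_shift A) U"
      unfolding full_shift_def U_def using fin aA
      by (intro product_topology_basis) auto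
    moreover have "\<alpha> \<in> U"
      using aA by (auto simp: U_def)
    moreover have "U \<subseteq> topspace (full_shift A) - \<Sigma>"
    proof
      fix \<beta> assume b: "\<beta> \<in> U"
      have c: "\<beta> i \<in> (if i \<in> F then {\<alpha> i} else A)" for i
        using b by (auto simp: U_def PiE_iff)
      have "\<beta> i \<in> A" for i
        using c[of i] aA[of i] by (auto split: if_splits)
      moreover have "\<forall>i\<in>F. \<beta> i = \<alpha> i"
        using c by (metis singletonD)
      ultimately show "\<beta> \<in> topspace (full_shift A) - \<Sigma>"
        using F(2) by (auto simp: full_shift_def PiE_iff)
    qed
    ultimately show "\<exists>T. openin (full_shift A) T \<and> \<alpha> \<in> T \<and> T \<subseteq> topspace (full_shift A) - \<Sigma>"
      by blast
  qed
  then show ?thesis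
    using sub by (simp add: closedin_def)
qed

lemma induced_graph_shiftI:
  "\<alpha> \<in> \<Sigma> \<Longrightarrow> shift \<alpha> \<noteq> \<alpha> \<Longrightarrow> (\<alpha>, shift \<alpha>) \<in> induced_graph \<Sigma> shift"
  by (force simp: induced_graph_def)

text \<open>Adjacent points differ by one application of the shift or of its inverse, so a walk of
  length \<open>n\<close> displaces its starting point by some \<open>s\<close> with \<open>\<bar>s\<bar> \<le> n\<close> and of the parity of \<open>n\<close>.
  When \<open>n\<close> is odd and the walk is closed, \<open>s\<close> is therefore a nonzero period.\<close>

lemma shift_hom_odd_period:
  assumes hom: "induced_graph \<Sigma> shift \<subseteq> inv_image (induced_graph \<Sigma>' shift) \<phi>"
    and mem: "\<And>i. (shift ^^ i) \<alpha> \<in> \<Sigma>"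
    and nofix: "\<And>\<beta>. \<beta> \<in> \<Sigma> \<Longrightarrow> shift \<beta> \<noteq> \<beta>"
    and per: "(shift ^^ n) \<alpha> = \<alpha>" and "odd n"
  obtains m where "odd m" "m \<le> n" "(shift ^^ m) (\<phi> \<alpha>) = \<phi> \<alpha>"
proof -
  have step: "\<phi> ((shift ^^ Suc i) \<alpha>) = shift (\<phi> ((shift ^^ i) \<alpha>)) \<or>
      \<phi> ((shift ^^ i) \<alpha>) = shift (\<phi> ((shift ^^ Suc i) \<alpha>))" for i
  proof -
    have "((shift ^^ i) \<alpha>, shift ((shift ^^ i) \<alpha>)) \<in> induced_graph \<Sigma> shift"
      using mem nofix by (blast intro: induced_graph_shiftI)
    then have "(\<phi> ((shift ^^ i) \<alpha>), \<phi> ((shift ^^ Suc i) \<alpha>)) \<in> induced_graph \<Sigma>' shift"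
      using hom by auto
    then show ?thesis
      by (auto simp: induced_graph_def)
  qed
  have "\<exists>s::int. \<phi> ((shift ^^ i) \<alpha>) = (\<lambda>k. \<phi> \<alpha> (k + s)) \<and> \<bar>s\<bar> \<le> int i \<and> (odd s \<longleftrightarrow> odd i)" for i
  proof (induction i)
    case 0
    show ?case by (rule exI[of _ 0]) auto
  next
    case (Suc i)
    then obtain s where s: "\<phi> ((shift ^^ i) \<alpha>) = (\<lambda>k. \<phi> \<alpha> (k + s))" "\<bar>s\<bar> \<le> int i"
      "odd s \<longleftrightarrow> odd i" by blast
    from step[of i] show ?case
    proof
      assume "\<phi> ((shift ^^ Suc i) \<alpha>) = shift (\<phi> ((shift ^^ i) \<alpha>))"
      then have "\<phi> ((shift ^^ Suc i) \<alpha>) = (\<lambda>k. \<phi> \<alpha> (k + (s + 1)))"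
        unfolding s(1) by (simp add: shift_def algebra_simps)
      then show ?thesis
        using s(2,3) by (intro exI[of _ "s + 1"]) auto
    next
      assume eq: "\<phi> ((shift ^^ i) \<alpha>) = shift (\<phi> ((shift ^^ Suc i) \<alpha>))"
      have "\<phi> ((shift ^^ Suc i) \<alpha>) k = \<phi> \<alpha> (k + (s - 1))" for k
        using fun_cong[OF eq, of "k - 1"] unfolding s(1) by (simp add: shift_def algebra_simps)
      then show ?thesis
        using s(2,3) by (intro exI[of _ "s - 1"]) auto
    qed
  qed
  from this[of n] obtain s where s: "\<phi> \<alpha> = (\<lambda>k. \<phi> \<alpha> (k + s))" "\<bar>s\<bar> \<le> int n" "odd s"
    using per \<open>odd n\<close> by auto
  have fwd: "\<phi> \<alpha> k = \<phi> \<alpha> (k + s)" for k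
    using fun_cong[OF s(1)] .
  have bwd: "\<phi> \<alpha> k = \<phi> \<alpha> (k - s)" for k
    using fwd[of "k - s"] by simp
  have "(shift ^^ nat \<bar>s\<bar>) (\<phi> \<alpha>) = \<phi> \<alpha>"
  proof
    fix k
    show "(shift ^^ nat \<bar>s\<bar>) (\<phi> \<alpha>) k = \<phi> \<alpha> k"
      using fwd[of k] bwd[of k] by (cases "s \<ge> 0") (auto simp: shift_funpow)
  qed
  moreover have "odd (nat \<bar>s\<bar>)"
    using s(3) by (simp add: even_nat_iff)
  ultimately show ?thesis
    using that s(2) by (metis nat_le_iff)
qed

text \<open>Along the orbit of a periodic point two colours would have to alternate.\<close>

lemma odd_period_not_two_colourable:
  assumes col: "continuous_colouring X (induced_graph \<Sigma> shift) \<kappa> c"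
    and top: "topspace X = \<Sigma>"
    and mem: "\<And>i. (shift ^^ i) \<alpha> \<in> \<Sigma>"
    and nofix: "\<And>\<beta>. \<beta> \<in> \<Sigma> \<Longrightarrow> shift \<beta> \<noteq> \<beta>"
    and per: "(shift ^^ n) \<alpha> = \<alpha>" and "odd n"
  shows "3 \<le> \<kappa>"
proof (rule ccontr)
  assume "\<not> 3 \<le> \<kappa>"
  then have k: "\<kappa> < enat 3" by (simp add: numeral_eq_enat)
  have two: "c ((shift ^^ i) \<alpha>) < 2" for i
  proof -
    have "enat (c ((shift ^^ i) \<alpha>)) < \<kappa>"
      using col mem[of i] top by (auto simp: continuous_colouring_def continuous_map_def)
    with k show ?thesis
      by (cases \<kappa>) auto
  qed
  have ne: "c ((shift ^^ i) \<alpha>) \<noteq> c ((shift ^^ Suc i) \<alpha>)" for i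
    using col induced_graph_shiftI[OF mem nofix[OF mem], of i]
    by (auto simp: continuous_colouring_def)
  have "even (c ((shift ^^ i) \<alpha>)) \<longleftrightarrow> (even (c \<alpha>) \<longleftrightarrow> even i)" for i
  proof (induction i)
    case (Suc i)
    have "even (c ((shift ^^ Suc i) \<alpha>)) \<longleftrightarrow> odd (c ((shift ^^ i) \<alpha>))"
      using ne[of i] two[of i] two[of "Suc i"] by (auto simp: less_2_cases_iff)
    with Suc show ?case by auto
  qed simp
  from this[of n] per \<open>odd n\<close> show False by simp
qed

section \<open>Sequences with spaced defects\<close>

definition symbol_step :: "nat \<Rightarrow> nat \<Rightarrow> bool" where
  "symbol_step a b \<longleftrightarrow> a < 4 \<and> (b = (a + 1) mod 4 \<or> a = 2 \<and> b = 0)"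

definition defect :: "(int \<Rightarrow> nat) \<Rightarrow> int \<Rightarrow> bool" where
  "defect \<alpha> k \<longleftrightarrow> \<alpha> k = 2 \<and> \<alpha> (k + 1) = 0"

definition spaced :: "nat \<Rightarrow> (int \<Rightarrow> nat) set" where
  "spaced d = {\<alpha>. (\<forall>k. symbol_step (\<alpha> k) (\<alpha> (k + 1))) \<and>
     (\<forall>k l. defect \<alpha> k \<longrightarrow> defect \<alpha> l \<longrightarrow> k < l \<longrightarrow> int d \<le> l - k)}"

lemma symbol_step_cases:
  assumes "symbol_step a b"
  shows "a = 0 \<and> b = 1 \<or> a = 1 \<and> b = 2 \<or> a = 2 \<and> b = 3 \<or> a = 3 \<and> b = 0 \<or> a = 2 \<and> b = 0"
proof -
  have "a = 0 \<or> a = 1 \<or> a = 2 \<or> a = 3"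
    using assms unfolding symbol_step_def by arith
  then show ?thesis
    using assms unfolding symbol_step_def by (elim disjE) simp_all
qed

lemma spaced_step: "\<alpha> \<in> spaced d \<Longrightarrow> symbol_step (\<alpha> k) (\<alpha> (k + 1))"
  by (simp add: spaced_def)

lemma spaced_antimono: "d \<le> e \<Longrightarrow> spaced e \<subseteq> spaced d"
  by (force simp: spaced_def)

lemma spaced_translate:
  assumes "\<alpha> \<in> spaced d"
  shows "(\<lambda>k. \<alpha> (k + s)) \<in> spaced d"
proof -
  have eq: "k + 1 + s = k + s + 1" for k :: int by simp
  have "int d \<le> l - k"
    if "defect (\<lambda>k. \<alpha> (k + s)) k" "defect (\<lambda>k. \<alpha> (k + s)) l" "k < l" for k l
  proof -
    have "defect \<alpha> (k + s)" "defect \<alpha> (l + s)"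
      using that by (auto simp: defect_def eq)
    then have "int d \<le> (l + s) - (k + s)"
      using assms \<open>k < l\<close> unfolding spaced_def by (metis (mono_tags, lifting) add_less_cancel_right mem_Collect_eq)
    then show ?thesis by simp
  qed
  then show ?thesis
    using spaced_step[OF assms] by (auto simp: spaced_def eq)
qed

lemma spaced_shift_image: "shift ` spaced d = spaced d"
proof
  show "shift ` spaced d \<subseteq> spaced d"
    using spaced_translate[of _ d 1] by (auto simp: shift_def)
  show "spaced d \<subseteq> shift ` spaced d"
  proof
    fix \<alpha> assume "\<alpha> \<in> spaced d"
    then have "(\<lambda>k. \<alpha> (k + (- 1))) \<in> spaced d"
      by (rule spaced_translate)
    moreover have "\<alpha> = shift (\<lambda>k. \<alpha> (k + (- 1)))"
      by (auto simp: shift_def)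
    ultimately show "\<alpha> \<in> shift ` spaced d"
      by blast
  qed
qed

lemma spaced_subset_topspace: "spaced d \<subseteq> topspace (full_shift {..<4})"
  using spaced_step by (fastforce simp: full_shift_def PiE_iff symbol_step_def)

text \<open>Whether \<open>\<alpha>\<close> violates one of the conditions is seen on two or four coordinates.\<close>

lemma spaced_subshift: "two_sided_subshift {..<4} (spaced d)"
  unfolding two_sided_subshift_def
proof
  show "closedin (full_shift {..<4}) (spaced d)"
  proof (rule closedin_full_shift_if_local[OF spaced_subset_topspace])
    fix \<alpha> assume "\<alpha> \<in> topspace (full_shift {..<4}) - spaced d"
    then have "\<alpha> \<notin> spaced d" by blast
    then consider k where "\<not> symbol_step (\<alpha> k) (\<alpha> (k + 1))"
      | k l where "defect \<alpha> k" "defect \<alpha> l" "k < l" "\<not> int d \<le> l - k"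
      unfolding spaced_def by blast
    then show "\<exists>F. finite F \<and> (\<forall>\<beta>. (\<forall>i\<in>F. \<beta> i = \<alpha> i) \<longrightarrow> \<beta> \<notin> spaced d)"
    proof cases
      case 1
      then show ?thesis
        by (intro exI[of _ "{k, k + 1}"]) (auto dest: spaced_step[where k = k])
    next
      case 2
      then show ?thesis
        by (intro exI[of _ "{k, k + 1, l, l + 1}"]) (auto simp: spaced_def defect_def)
    qed
  qed
qed (rule spaced_shift_image)

lemma spaced_no_fixed_point:
  assumes "\<alpha> \<in> spaced d"
  shows "shift \<alpha> \<noteq> \<alpha>"
proof
  assume "shift \<alpha> = \<alpha>"
  then have "\<alpha> (0 + 1) = \<alpha> 0"
    by (metis shift_def)
  moreover have "symbol_step (\<alpha> 0) (\<alpha> (0 + 1))"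
    using assms by (rule spaced_step)
  ultimately have "symbol_step (\<alpha> 0) (\<alpha> 0)"
    by simp
  then show False
    using symbol_step_cases by fastforce
qed

lemma spaced_no_period_two:
  assumes "\<alpha> \<in> spaced d"
  shows "(shift ^^ 2) \<alpha> \<noteq> \<alpha>"
proof
  assume "(shift ^^ 2) \<alpha> = \<alpha>"
  then have "\<alpha> (0 + 2) = \<alpha> 0"
    by (metis shift_funpow of_nat_numeral)
  moreover have "symbol_step (\<alpha> 0) (\<alpha> (0 + 1))" "symbol_step (\<alpha> 1) (\<alpha> (1 + 1))"
    using assms by (rule spaced_step)+
  ultimately have "symbol_step (\<alpha> 0) (\<alpha> 1)" "symbol_step (\<alpha> 1) (\<alpha> 0)"
    by simp_all
  then show False
    by (auto dest!: symbol_step_cases)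
qed

text \<open>Away from defects each step changes the parity of the symbol, so an odd period forces a
  defect; the period carries it to another one.\<close>

lemma odd_period_ge:
  assumes a: "\<alpha> \<in> spaced d" and per: "(shift ^^ m) \<alpha> = \<alpha>" and "odd m"
  shows "d \<le> m"
proof -
  have per': "\<alpha> (k + int m) = \<alpha> k" for k
    using fun_cong[OF per, of k] by (simp only: shift_funpow)
  have "\<exists>k. defect \<alpha> k"
  proof (rule ccontr)
    assume nd: "\<not> (\<exists>k. defect \<alpha> k)"
    have flip: "even (\<alpha> (k + 1)) \<longleftrightarrow> odd (\<alpha> k)" for k
    proof -
      have "\<not> (\<alpha> k = 2 \<and> \<alpha> (k + 1) = 0)"
        using nd by (auto simp: defect_def)
      then show ?thesis
        using symbol_step_cases[OF spaced_step[OF a, of k]] by auto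
    qed
    have "even (\<alpha> (int i)) \<longleftrightarrow> (even (\<alpha> 0) \<longleftrightarrow> even i)" for i
    proof (induction i)
      case (Suc i)
      moreover have "int (Suc i) = int i + 1" by simp
      ultimately show ?case using flip[of "int i"] by (metis even_Suc)
    qed simp
    from this[of m] per'[of 0] \<open>odd m\<close> show False by simp
  qed
  then obtain k where k: "defect \<alpha> k" by blast
  then have "defect \<alpha> (k + int m)"
    using per'[of k] per'[of "k + 1"] by (simp add: defect_def algebra_simps)
  moreover have "k < k + int m"
    using \<open>odd m\<close> by (auto elim: oddE)
  ultimately have "int d \<le> (k + int m) - k"
    using a k unfolding spaced_def by blast
  then show ?thesis by simp
qed

definition defect_cycle :: "nat \<Rightarrow> int \<Rightarrow> nat" where
  "defect_cycle p k = nat (k mod (4 * int p + 3)) mod 4"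

lemma defect_cycle_period: "(shift ^^ (4 * p + 3)) (defect_cycle p) = defect_cycle p"
proof
  fix k
  have "(k + (4 * int p + 3)) mod (4 * int p + 3) = k mod (4 * int p + 3)"
    by (rule mod_add_self2)
  moreover have "int (4 * p + 3) = 4 * int p + 3" by simp
  ultimately show "(shift ^^ (4 * p + 3)) (defect_cycle p) k = defect_cycle p k"
    unfolding shift_funpow defect_cycle_def by presburger
qed

text \<open>A period of length \<open>n = 4 p + 3\<close> ends in the symbol \<open>2\<close>, since \<open>n - 1\<close> is congruent to \<open>2\<close>
  modulo \<open>4\<close>.  So restarting the count there is a legal shortcut, and it is the only defect in the
  period.\<close>

lemma defect_cycle_in_spaced: "defect_cycle p \<in> spaced (4 * p + 3)"
proof -
  define n where "n = 4 * int p + 3"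
  have n: "n > 0" by (simp add: n_def)
  have val: "defect_cycle p k = nat (k mod n) mod 4" for k
    by (simp add: defect_cycle_def n_def)
  have last: "defect_cycle p k = 2 \<and> defect_cycle p (k + 1) = 0" if "k mod n = n - 1" for k
  proof -
    have "(k + 1) mod n = (k mod n + 1) mod n"
      by (simp add: mod_simps)
    then have "(k + 1) mod n = 0"
      using that by simp
    moreover have "nat (n - 1) = 4 * p + 2"
      by (simp add: n_def)
    ultimately show ?thesis
      using that unfolding val by (simp add: mod_Suc)
  qed
  have inner: "defect_cycle p (k + 1) = (defect_cycle p k + 1) mod 4" if "k mod n \<noteq> n - 1" for k
  proof -
    have "0 \<le> k mod n" "k mod n < n"
      using n by auto
    then have "k mod n + 1 < n"
      using that by linarith
    then have "(k + 1) mod n = k mod n + 1"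
      using \<open>0 \<le> k mod n\<close> by (metis mod_add_left_eq mod_pos_pos_trivial add_nonneg_nonneg zero_le_one)
    then have "nat ((k + 1) mod n) = nat (k mod n) + 1"
      using \<open>0 \<le> k mod n\<close> by simp
    then show ?thesis
      unfolding val by (simp add: mod_simps)
  qed
  have "symbol_step (defect_cycle p k) (defect_cycle p (k + 1))" for k
  proof (cases "k mod n = n - 1")
    case True
    then show ?thesis using last[of k] by (simp add: symbol_step_def)
  next
    case False
    then have "defect_cycle p (k + 1) = (defect_cycle p k + 1) mod 4"
      by (rule inner)
    moreover have "defect_cycle p k < 4"
      by (simp add: val)
    ultimately show ?thesis
      by (simp only: symbol_step_def) simp
  qed
  moreover have "int (4 * p + 3) \<le> l - k"
    if "defect (defect_cycle p) k" "defect (defect_cycle p) l" "k < l" for k l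
  proof -
    have "i mod n = n - 1" if "defect (defect_cycle p) i" for i
      using that inner[of i] by (auto simp: defect_def)
    then have "k mod n = l mod n"
      using that by simp
    then have "n dvd l - k"
      by (metis mod_eq_dvd_iff)
    then show ?thesis
      using zdvd_imp_le[of n "l - k"] \<open>k < l\<close> by (simp add: n_def)
  qed
  ultimately show ?thesis
    by (simp add: spaced_def)
qed

lemma defect_cycle_orbit: "(shift ^^ i) (defect_cycle p) \<in> spaced (4 * p + 3)"
  unfolding shift_funpow by (rule spaced_translate[OF defect_cycle_in_spaced])

lemma topspace_spaced: "topspace (subshift_space {..<4} (spaced d)) = spaced d"
  using spaced_subset_topspace by (auto simp: subshift_space_def)

text \<open>The colour is the symbol at the origin with \<open>1\<close> and \<open>3\<close> identified: every step and every
  defect joins two different classes.\<close>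

lemma spaced_three_colouring:
  "continuous_colouring (subshift_space {..<4} (spaced d)) (induced_graph (spaced d) shift) 3
     (\<lambda>\<alpha>. if \<alpha> 0 = 3 then 1 else \<alpha> 0)"
proof -
  define c :: "nat \<Rightarrow> nat" where "c a = (if a = 3 then 1 else a)" for a
  have "continuous_map (subshift_space {..<4} (spaced d)) (discrete_topology {..<4}) (\<lambda>\<alpha>. \<alpha> 0)"
    unfolding subshift_space_def full_shift_def
    by (intro continuous_map_from_subtopology continuous_map_product_projection) simp
  moreover have "continuous_map (discrete_topology {..<4}) (discrete_topology {i. enat i < 3}) c"
    by (auto simp: c_def numeral_eq_enat)
  ultimately have "continuous_map (subshift_space {..<4} (spaced d))
      (discrete_topology {i. enat i < 3}) (\<lambda>\<alpha>. c (\<alpha> 0))"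
    by (rule continuous_map_compose[unfolded o_def])
  moreover have "c (\<alpha> 0) \<noteq> c (shift \<alpha> 0)" if "\<alpha> \<in> spaced d" for \<alpha>
    using symbol_step_cases[OF spaced_step[OF that, of 0]] by (auto simp: c_def shift_def)
  then have "\<forall>(x, y) \<in> induced_graph (spaced d) shift. c (x 0) \<noteq> c (y 0)"
    by (force simp: induced_graph_def)
  ultimately show ?thesis
    by (simp add: continuous_colouring_def c_def)
qed

lemma spaced_ccn:
  "ccn (subshift_space {..<4} (spaced (4 * p + 3))) (induced_graph (spaced (4 * p + 3)) shift)
     = Countable 3"
proof -
  let ?X = "subshift_space {..<4} (spaced (4 * p + 3))"
  let ?R = "induced_graph (spaced (4 * p + 3)) shift"
  have "(LEAST \<kappa>. \<exists>c. continuous_colouring ?X ?R \<kappa> c) = 3"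
  proof (rule Least_equality)
    show "\<exists>c. continuous_colouring ?X ?R 3 c"
      using spaced_three_colouring by blast
  next
    fix \<kappa> assume "\<exists>c. continuous_colouring ?X ?R \<kappa> c"
    then show "3 \<le> \<kappa>"
      using odd_period_not_two_colourable[OF _ topspace_spaced defect_cycle_orbit
          spaced_no_fixed_point defect_cycle_period] by auto
  qed
  then show ?thesis
    unfolding ccn_def using spaced_three_colouring by auto
qed

section \<open>The descending chain\<close>

lemma spaced_reducible_ci:
  assumes "d \<le> e"
  shows "shift_graph {..<4} (spaced e) \<preceq>\<^sub>c\<^sub>i shift_graph {..<4} (spaced d)"
proof -
  have "continuous_map (subshift_space {..<4} (spaced e)) (subshift_space {..<4} (spaced d)) id"
    using spaced_antimono[OF assms] unfolding subshift_space_def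
    by (auto simp: continuous_map_in_subtopology intro: continuous_map_from_subtopology)
  moreover have "induced_graph (spaced e) shift \<subseteq> induced_graph (spaced d) shift"
    using spaced_antimono[OF assms] by (auto simp: induced_graph_def)
  ultimately show ?thesis
    unfolding reducible_ci_def shift_graph_def by (intro exI[of _ id]) auto
qed

lemma reducible_ci_imp_c: "G \<preceq>\<^sub>c\<^sub>i H \<Longrightarrow> G \<preceq>\<^sub>c H"
  by (auto simp: reducible_ci_def reducible_c_def)

lemma spaced_not_reducible:
  "\<not> shift_graph {..<4} (spaced (4 * p + 3)) \<preceq>\<^sub>c shift_graph {..<4} (spaced (4 * Suc p + 3))"
proof
  assume "shift_graph {..<4} (spaced (4 * p + 3)) \<preceq>\<^sub>c
    shift_graph {..<4} (spaced (4 * Suc p + 3))"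
  then obtain \<phi> where
    cont: "continuous_map (subshift_space {..<4} (spaced (4 * p + 3)))
      (subshift_space {..<4} (spaced (4 * Suc p + 3))) \<phi>"
    and hom: "induced_graph (spaced (4 * p + 3)) shift
      \<subseteq> inv_image (induced_graph (spaced (4 * Suc p + 3)) shift) \<phi>"
    by (auto simp: reducible_c_def shift_graph_def)
  have "\<phi> (defect_cycle p) \<in> spaced (4 * Suc p + 3)"
    using cont defect_cycle_in_spaced[of p]
    by (auto simp: continuous_map_def topspace_spaced)
  moreover obtain m where "odd m" "m \<le> 4 * p + 3"
      "(shift ^^ m) (\<phi> (defect_cycle p)) = \<phi> (defect_cycle p)"
    using shift_hom_odd_period[OF hom defect_cycle_orbit
        spaced_no_fixed_point[where d = "4 * p + 3"] defect_cycle_period]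
    by auto
  ultimately show False
    using odd_period_ge by fastforce
qed

theorem theorem10p5:
  "\<exists>(A :: nat \<Rightarrow> nat set) (\<Sigma> :: nat \<Rightarrow> (int \<Rightarrow> nat) set).
     (\<forall>p. alphabet (A p) \<and> two_sided_subshift (A p) (\<Sigma> p) \<and>
          (\<forall>\<alpha> \<in> \<Sigma> p. (shift ^^ 2) \<alpha> \<noteq> \<alpha>) \<and>
          ccn (subshift_space (A p) (\<Sigma> p)) (induced_graph (\<Sigma> p) shift) = Countable 3) \<and>
     (\<forall>p. shift_graph (A (Suc p)) (\<Sigma> (Suc p)) \<preceq>\<^sub>c\<^sub>i shift_graph (A p) (\<Sigma> p) \<and>
          shift_graph (A (Suc p)) (\<Sigma> (Suc p)) \<preceq>\<^sub>c shift_graph (A p) (\<Sigma> p) \<and>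
          \<not> shift_graph (A p) (\<Sigma> p) \<preceq>\<^sub>c shift_graph (A (Suc p)) (\<Sigma> (Suc p)) \<and>
          \<not> shift_graph (A p) (\<Sigma> p) \<preceq>\<^sub>c\<^sub>i shift_graph (A (Suc p)) (\<Sigma> (Suc p)))"
proof (rule exI[of _ "\<lambda>_. {..<4}"], rule exI[of _ "\<lambda>p. spaced (4 * p + 3)"], intro conjI allI ballI)
  fix p
  show "alphabet {..<4::nat}"
    by (simp add: alphabet_def)
  show "two_sided_subshift {..<4} (spaced (4 * p + 3))"
    by (rule spaced_subshift)
  show "ccn (subshift_space {..<4} (spaced (4 * p + 3)))
      (induced_graph (spaced (4 * p + 3)) shift) = Countable 3"
    by (rule spaced_ccn)
  show ci: "shift_graph {..<4} (spaced (4 * Suc p + 3)) \<preceq>\<^sub>c\<^sub>i shift_graph {..<4} (spaced (4 * p + 3))"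
    by (rule spaced_reducible_ci) simp
  then show "shift_graph {..<4} (spaced (4 * Suc p + 3)) \<preceq>\<^sub>c shift_graph {..<4} (spaced (4 * p + 3))"
    by (rule reducible_ci_imp_c)
  show "\<not> shift_graph {..<4} (spaced (4 * p + 3)) \<preceq>\<^sub>c shift_graph {..<4} (spaced (4 * Suc p + 3))"
    by (rule spaced_not_reducible)
  then show "\<not> shift_graph {..<4} (spaced (4 * p + 3)) \<preceq>\<^sub>c\<^sub>i
      shift_graph {..<4} (spaced (4 * Suc p + 3))"
    using reducible_ci_imp_c by blast
next
  fix p \<alpha> assume "\<alpha> \<in> spaced (4 * p + 3)"
  then show "(shift ^^ 2) \<alpha> \<noteq> \<alpha>"
    by (rule spaced_no_period_two)
qed

end
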